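(* Let $d>1$ and let $\psi:\mathbb{R}\to\mathbb{R}$ be a polynomial with real coefficients of degree $N>1$. Then for every $d'$ with $d\le d'<\frac{2N-1}{N}d$ there is $f\in\Sigma_d(\mathbb{R})$ such that $f\circ\psi\notin\Sigma_{d'}(\mathbb{R})$. In particular, for any real polynomial $\psi$ of degree greater than one and any $d'$ with $d\le d'<\frac32 d$ there is $f\in\Sigma_d(\mathbb{R})$ such that $f\circ\psi\notin\Sigma_{d'}(\mathbb{R})$.
   Context: For $d>1$, the Gelfand-Shilov space $\Sigma_d(\mathbb{R})$ (of Beurling type) consists of all (complex-valued) $f\in C^\infty(\mathbb{R})$ such that for every $h>0$, $\displaystyle\sup_{x\in\mathbb{R}}\sup_{j,\ell\in\mathbb{N}_0}\frac{|x^\ell f^{(j)}(x)|}{h^{j+\ell}\,((j+\ell)!)^d}<\infty$. *)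

theory Defs
  imports "HOL-Analysis.Analysis" "HOL-Computational_Algebra.Polynomial"
begin

definition nth_vderiv :: "nat \<Rightarrow> (real \<Rightarrow> complex) \<Rightarrow> real \<Rightarrow> complex" where
  "nth_vderiv j f = ((\<lambda>g x. vector_derivative g (at x)) ^^ j) f"

(* vector_derivative is total, so differentiability of every iterate must be required explicitly. *)
definition smooth_fun :: "(real \<Rightarrow> complex) \<Rightarrow> bool" where
  "smooth_fun f \<longleftrightarrow> (\<forall>j x. nth_vderiv j f differentiable (at x))"

(* Beurling type: the bound is required for every h > 0, with a constant that may depend on h
   but not on x, j, l. The finite supremum is rendered as boundedness above. *)
definition gelfand_shilov :: "real \<Rightarrow> (real \<Rightarrow> complex) set" where
  "gelfand_shilov d = {f. smooth_fun f \<and>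
     (\<forall>h>0. bdd_above (range (\<lambda>(x :: real, j :: nat, l :: nat).
        norm (x ^ l *\<^sub>R nth_vderiv j f x) / (h ^ (j + l) * fact (j + l) powr d))))}"

end

theory Submission imports Defs "HOL-Real_Asymp.Real_Asymp"
begin

text \<open>
  After replacing \<open>f\<close> by \<open>f(-x)\<close> we may assume that \<open>\<psi>\<close> has positive leading coefficient. Choose
  \<open>1 < s < d\<close> with \<open>d' < (2 - 1/N) s\<close> and let \<open>f\<close> be a sum, over \<open>k\<close> in a sparse set, of Gaussians
  \<open>exp(-2k) exp(-(\<xi>\<^sub>k (y - c\<^sub>k))\<^sup>2)\<close> with \<open>\<xi>\<^sub>k = k\<^bsup>s-1/2\<^esup>\<close> and \<open>c\<^sub>k\<close> of order \<open>k\<^sup>s\<close>. The centers \<open>c\<^sub>k\<close> lie to the right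
  of \<open>y\<^sub>k = \<psi>(k\<^bsup>s/N\<^esup>)\<close> by exactly the distance that makes the first \<open>k\<close> derivatives of the \<open>k\<close>-th Gaussian
  positive at \<open>y\<^sub>k\<close>; the \<open>k\<close>-th one is then at least \<open>C\<^sup>-\<^sup>k k\<^bsup>sk\<^esup>\<close>. Since the derivatives of \<open>\<psi>\<close> are
  positive far out too, no cancellation occurs in Faa di Bruno's formula and \<open>(f \<circ> \<psi>)\<^bsup>(k)\<^esup>\<close> is at least
  \<open>C\<^sup>-\<^sup>k k\<^bsup>sk\<^esup> \<psi>'(k\<^bsup>s/N\<^esup>)\<^sup>k\<close>, that is \<open>c\<^sup>k k\<^bsup>sk(2-1/N)\<^esup>\<close>, which beats \<open>(k!)\<^bsup>d'\<^esup>\<close>. The Gaussians further right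
  only help. Those further left form a finite sum, whose composition with \<open>\<psi>\<close> may be assumed to lie
  in the target space (otherwise it is the desired example), so a gliding hump argument
  handles them.
\<close>

subsection \<open>Functions with all their derivatives\<close>

text \<open>Carrying all derivatives as explicit data avoids iterating the total operator
  \<open>vector_derivative\<close>; smoothness then comes for free.\<close>

definition deriv_seq :: "(nat \<Rightarrow> real \<Rightarrow> real) \<Rightarrow> bool" where
  "deriv_seq G \<longleftrightarrow> (\<forall>n x. (G n has_real_derivative G (Suc n) x) (at x))"

lemma deriv_seq_nth_vderiv:
  assumes "deriv_seq G"
  shows "nth_vderiv n (\<lambda>x. complex_of_real (G 0 x)) = (\<lambda>x. complex_of_real (G n x))"
proof (induction n)
  case 0
  show ?case by (simp add: nth_vderiv_def)
next
  case (Suc n)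
  have "((\<lambda>y. complex_of_real (G n y)) has_vector_derivative complex_of_real (G (Suc n) x)) (at x)" for x
    using assms has_vector_derivative_of_real unfolding deriv_seq_def by blast
  then show ?case
    using Suc by (auto simp: nth_vderiv_def vector_derivative_at)
qed

lemma deriv_seq_smooth_fun:
  assumes "deriv_seq G"
  shows "smooth_fun (\<lambda>x. complex_of_real (G 0 x))"
  unfolding smooth_fun_def deriv_seq_nth_vderiv[OF assms]
proof (intro allI)
  fix j x
  have "((\<lambda>y. complex_of_real (G j y)) has_vector_derivative complex_of_real (G (Suc j) x)) (at x)"
    using assms has_vector_derivative_of_real unfolding deriv_seq_def by blast
  then show "(\<lambda>y. complex_of_real (G j y)) differentiable at x"
    using differentiableI_vector by blast
qed

lemma deriv_seq_gelfand_shilov_iff: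
  assumes "deriv_seq G"
  shows "(\<lambda>x. complex_of_real (G 0 x)) \<in> gelfand_shilov d \<longleftrightarrow>
    (\<forall>h>0. \<exists>C. \<forall>x j l. \<bar>x ^ l * G j x\<bar> \<le> C * (h ^ (j + l) * fact (j + l) powr d))"
proof -
  have "bdd_above (range (\<lambda>(x, j, l). norm (x ^ l *\<^sub>R complex_of_real (G j x)) /
          (h ^ (j + l) * fact (j + l) powr d))) \<longleftrightarrow>
        (\<exists>C. \<forall>x j l. \<bar>x ^ l * G j x\<bar> \<le> C * (h ^ (j + l) * fact (j + l) powr d))"
    if "h > 0" for h :: real
  proof -
    have "h ^ n * fact n powr d > 0" for n :: nat
      using that by simp
    then show ?thesis
      by (simp add: bdd_above_def pos_divide_le_eq abs_mult)
  qed
  then show ?thesis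
    by (simp add: gelfand_shilov_def deriv_seq_smooth_fun[OF assms] deriv_seq_nth_vderiv[OF assms])
qed

lemma deriv_seq_reflect:
  assumes "deriv_seq G"
  shows "deriv_seq (\<lambda>n x. (- 1) ^ n * G n (- x))"
  unfolding deriv_seq_def
proof (intro allI)
  fix n x
  have "((\<lambda>y. G n (- y)) has_real_derivative - G (Suc n) (- x)) (at x)"
    using assms by (intro DERIV_mirror[THEN iffD1]) (simp add: deriv_seq_def)
  from DERIV_cmult[OF this, of "(-1)^n"]
  show "((\<lambda>y. (- 1) ^ n * G n (- y)) has_real_derivative (- 1) ^ Suc n * G (Suc n) (- x)) (at x)"
    by simp
qed

text \<open>Reflection only changes signs, which the absolute value absorbs. This serves polynomials
  with negative leading coefficient.\<close>

lemma gelfand_shilov_reflect: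
  assumes "deriv_seq G" "(\<lambda>x. complex_of_real (G 0 x)) \<in> gelfand_shilov d"
  shows "(\<lambda>x. complex_of_real (G 0 (- x))) \<in> gelfand_shilov d"
proof -
  have "\<exists>C. \<forall>x j l. \<bar>x ^ l * ((- 1) ^ j * G j (- x))\<bar> \<le> C * (h ^ (j + l) * fact (j + l) powr d)"
    if h: "h > 0" for h
  proof -
    obtain C where C: "\<And>x j l. \<bar>x ^ l * G j x\<bar> \<le> C * (h ^ (j + l) * fact (j + l) powr d)"
      using h assms(2) unfolding deriv_seq_gelfand_shilov_iff[OF assms(1)] by blast
    have "\<bar>x ^ l * ((- 1) ^ j * G j (- x))\<bar> = \<bar>(- x) ^ l * G j (- x)\<bar>" for x j l
      by (simp add: abs_mult power_abs)
    then show ?thesis using C by metis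
  qed
  then show ?thesis
    using deriv_seq_gelfand_shilov_iff[OF deriv_seq_reflect[OF assms(1)], of d] by simp
qed

text \<open>\<open>comp_deriv G p n m r\<close> is the \<open>n\<close>-th derivative of \<open>(G m \<circ> p) * r\<close>: moving the factors \<open>p'\<close> into
  the weight \<open>r\<close> replaces Faa di Bruno's formula.\<close>

fun comp_deriv :: "(nat \<Rightarrow> real \<Rightarrow> real) \<Rightarrow> real poly \<Rightarrow> nat \<Rightarrow> nat \<Rightarrow> real poly \<Rightarrow> real \<Rightarrow> real" where
  "comp_deriv G p 0 m r x = G m (poly p x) * poly r x"
| "comp_deriv G p (Suc n) m r x =
     comp_deriv G p n (Suc m) (r * pderiv p) x + comp_deriv G p n m (pderiv r) x"

text \<open>Case 0 is the product and chain rule. The recursion performs the first differentiation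
  outermost, so the inductive step is mere additivity.\<close>

lemma comp_deriv_has_derivative:
  assumes "deriv_seq G"
  shows "(comp_deriv G p n m r has_real_derivative comp_deriv G p (Suc n) m r x) (at x)"
proof (induction n arbitrary: m r)
  case 0
  have "(G m has_real_derivative G (Suc m) (poly p x)) (at (poly p x))"
    using assms by (simp add: deriv_seq_def)
  from DERIV_mult[OF DERIV_chain2[OF this poly_DERIV] poly_DERIV[of r x]]
  show ?case by (simp add: algebra_simps)
next
  case (Suc n)
  show ?case
    using DERIV_add[OF Suc[of "Suc m" "r * pderiv p"] Suc[of m "pderiv r"]] by simp
qed

lemma comp_deriv_seq:
  assumes "deriv_seq G"
  shows "deriv_seq (\<lambda>n. comp_deriv G p n 0 1)"
  unfolding deriv_seq_def using comp_deriv_has_derivative[OF assms] by blast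

lemma comp_deriv_add:
  assumes "\<And>m x. G m x = G1 m x + G2 m x"
  shows "comp_deriv G p n m r x = comp_deriv G1 p n m r x + comp_deriv G2 p n m r x"
  by (induction n arbitrary: m r) (simp_all add: assms algebra_simps)

subsection \<open>Lower bounds for derivatives of compositions\<close>

text \<open>Equivalently, all derivatives of \<open>r\<close> at \<open>x\<close> are non-negative.
  In terms of coefficients, stability under products and \<open>pderiv\<close> is immediate, and
  these are the operations that \<open>comp_deriv\<close> applies to its weight.\<close>

definition nonneg_taylor :: "real poly \<Rightarrow> real \<Rightarrow> bool" where
  "nonneg_taylor r x \<longleftrightarrow> (\<forall>i. coeff (r \<circ>\<^sub>p [:x, 1:]) i \<ge> 0)"

lemma nonneg_taylor_mult:
  "nonneg_taylor p x \<Longrightarrow> nonneg_taylor q x \<Longrightarrow> nonneg_taylor (p * q) x"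
  by (auto simp: nonneg_taylor_def pcompose_mult coeff_mult intro!: sum_nonneg)

lemma pderiv_shift: "pderiv r \<circ>\<^sub>p [:x, 1:] = pderiv (r \<circ>\<^sub>p [:x, 1:])" for r :: "real poly"
  by (simp add: pderiv_pcompose pderiv_pCons)

lemma nonneg_taylor_pderiv: "nonneg_taylor p x \<Longrightarrow> nonneg_taylor (pderiv p) x"
  by (simp add: nonneg_taylor_def pderiv_shift coeff_pderiv)

lemma coeff_0_shift: "coeff (r \<circ>\<^sub>p [:x, 1:]) 0 = poly r x" for r :: "real poly"
  by (simp add: poly_0_coeff_0[symmetric] poly_pcompose)

lemma nonneg_taylor_poly: "nonneg_taylor p x \<Longrightarrow> poly p x \<ge> 0"
  by (metis coeff_0_shift nonneg_taylor_def)

lemma nonneg_taylorI: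
  assumes "poly p x \<ge> 0" "nonneg_taylor (pderiv p) x"
  shows "nonneg_taylor p x"
  unfolding nonneg_taylor_def
proof
  fix i
  show "coeff (p \<circ>\<^sub>p [:x, 1:]) i \<ge> 0"
  proof (cases i)
    case 0
    then show ?thesis using assms(1) by (simp add: coeff_0_shift)
  next
    case (Suc k)
    have "coeff (pderiv (p \<circ>\<^sub>p [:x, 1:])) k \<ge> 0"
      using assms(2) by (simp add: nonneg_taylor_def pderiv_shift)
    then show ?thesis by (simp add: Suc coeff_pderiv zero_le_mult_iff)
  qed
qed

text \<open>Induction on the degree: the derivative again has positive leading coefficient, and it
  governs all Taylor coefficients except the constant one.\<close>

lemma eventually_nonneg_taylor:
  assumes "lead_coeff p > 0"
  shows "\<forall>\<^sub>F x in at_top. nonneg_taylor p x"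
  using assms
proof (induction "degree p" arbitrary: p)
  case 0
  then obtain a where "p = [:a:]" by (metis degree_eq_zeroE)
  with 0 show ?case by (simp add: nonneg_taylor_def coeff_pCons split: nat.split)
next
  case (Suc n)
  have "\<forall>\<^sub>F x in at_top. poly p x \<ge> lead_coeff p"
    using poly_pinfty_gt_lc[OF Suc.prems] by (auto simp: eventually_at_top_linorder)
  moreover have "\<forall>\<^sub>F x in at_top. nonneg_taylor (pderiv p) x"
    using Suc by (intro Suc.hyps(1)) (auto simp: degree_pderiv coeff_pderiv)
  ultimately show ?case
    by eventually_elim (use Suc.prems in \<open>auto intro!: nonneg_taylorI\<close>)
qed

text \<open>All terms of the expansion are non-negative, so it suffices to keep the one in which
  every differentiation hits \<open>G\<close>.\<close>

lemma comp_deriv_ge: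
  assumes p: "nonneg_taylor (pderiv p) x"
    and G: "\<And>i. i \<le> m + n \<Longrightarrow> G i (poly p x) \<ge> 0"
    and r: "nonneg_taylor r x"
  shows "comp_deriv G p n m r x \<ge> G (m + n) (poly p x) * poly (pderiv p) x ^ n * poly r x"
  using G r
proof (induction n arbitrary: m r)
  case 0
  then show ?case by simp
next
  case (Suc n)
  have 1: "comp_deriv G p n (Suc m) (r * pderiv p) x \<ge>
      G (Suc m + n) (poly p x) * poly (pderiv p) x ^ n * poly (r * pderiv p) x"
    using Suc.prems p by (intro Suc.IH nonneg_taylor_mult) auto
  have "comp_deriv G p n m (pderiv r) x \<ge>
      G (m + n) (poly p x) * poly (pderiv p) x ^ n * poly (pderiv r) x"
    using Suc.prems p by (intro Suc.IH nonneg_taylor_pderiv) auto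
  moreover have "G (m + n) (poly p x) * poly (pderiv p) x ^ n * poly (pderiv r) x \<ge> 0"
    using Suc.prems p
    by (intro mult_nonneg_nonneg zero_le_power) (auto intro: nonneg_taylor_poly nonneg_taylor_pderiv)
  ultimately show ?case using 1 by (simp add: mult_ac)
qed

subsection \<open>Gaussians\<close>

text \<open>The polynomial factor in the \<open>m\<close>-th derivative of \<open>exp(-u\<^sup>2)\<close>, i.e. \<open>(-1)\<^sup>m\<close> times the Hermite
  polynomial.\<close>

primrec gauss_poly :: "nat \<Rightarrow> real poly" where
  "gauss_poly 0 = 1"
| "gauss_poly (Suc m) = pderiv (gauss_poly m) - [:0, 2:] * gauss_poly m"

text \<open>The Hermite identity H_n' = 2 n H_(n-1) up to sign; it turns the defining recursion into
  a three-term recurrence.\<close>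

lemma pderiv_gauss_poly: "pderiv (gauss_poly (Suc m)) = smult (- 2 * real (Suc m)) (gauss_poly m)"
proof (induction m)
  case 0
  show ?case by (simp add: pderiv_pCons)
next
  case (Suc m)
  have "pderiv (gauss_poly (Suc (Suc m))) =
      pderiv (pderiv (gauss_poly (Suc m))) - pderiv ([:0, 2:] * gauss_poly (Suc m))"
    by (simp only: gauss_poly.simps(2) pderiv_diff)
  also have "\<dots> = smult (- 2 * real (Suc m)) (pderiv (gauss_poly m))
      - ([:0, 2:] * smult (- 2 * real (Suc m)) (gauss_poly m) + smult 2 (gauss_poly (Suc m)))"
    by (simp only: pderiv_mult Suc pderiv_smult) (simp add: pderiv_pCons)
  also have "\<dots> = smult (- 2 * real (Suc m)) (gauss_poly (Suc m)) - smult 2 (gauss_poly (Suc m))"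
    by (intro poly_eq_poly_eq_iff[THEN iffD1] ext) (simp add: algebra_simps)
  also have "\<dots> = smult (- 2 * real (Suc (Suc m))) (gauss_poly (Suc m))"
    by (simp add: smult_diff_left[symmetric] smult_add_left[symmetric] algebra_simps del: gauss_poly.simps)
  finally show ?case .
qed

lemma poly_gauss_poly_Suc_Suc:
  "poly (gauss_poly (Suc (Suc m))) u =
     - 2 * u * poly (gauss_poly (Suc m)) u - 2 * real (Suc m) * poly (gauss_poly m) u"
  by (subst gauss_poly.simps(2)) (simp add: pderiv_gauss_poly algebra_simps del: gauss_poly.simps)

text \<open>Induction along the three-term recurrence: its coefficient is at most 2
  \<open>j\<close>, hence at most \<open>2 * sqrt j * ?B\<close>, so the two terms add up to the
  next power of \<open>?B\<close>.\<close>

lemma gauss_poly_bound: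
  assumes "m \<le> j"
  shows "\<bar>poly (gauss_poly m) u\<bar> \<le> (2 * \<bar>u\<bar> + 2 * sqrt j) ^ m"
  using assms
proof (induction m rule: induct_nat_012)
  case 0
  show ?case by simp
next
  case 1
  show ?case by (simp add: abs_mult pderiv_pCons)
next
  case (ge2 m)
  let ?B = "2 * \<bar>u\<bar> + 2 * sqrt j"
  have "\<bar>poly (gauss_poly (Suc (Suc m))) u\<bar> \<le>
      \<bar>2 * u * poly (gauss_poly (Suc m)) u\<bar> + \<bar>2 * real (Suc m) * poly (gauss_poly m) u\<bar>"
    unfolding poly_gauss_poly_Suc_Suc by linarith
  also have "\<dots> = 2 * \<bar>u\<bar> * \<bar>poly (gauss_poly (Suc m)) u\<bar> + 2 * real (Suc m) * \<bar>poly (gauss_poly m) u\<bar>"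
    by (simp add: abs_mult)
  also have "\<dots> \<le> 2 * \<bar>u\<bar> * ?B ^ Suc m + 2 * real j * ?B ^ m"
    using ge2 by (intro add_mono mult_mono) (auto simp del: gauss_poly.simps)
  also have "\<dots> \<le> 2 * \<bar>u\<bar> * ?B ^ Suc m + 2 * sqrt j * ?B * ?B ^ m"
  proof -
    have "2 * real j \<le> 2 * sqrt j * (2 * sqrt j)" by simp
    also have "\<dots> \<le> 2 * sqrt j * ?B" by (intro mult_left_mono) auto
    finally show ?thesis by (intro add_left_mono mult_right_mono) auto
  qed
  also have "\<dots> = ?B ^ Suc (Suc m)" by (simp add: algebra_simps)
  finally show ?case .
qed

text \<open>At \<open>- v\<close> consecutive values keep a ratio of at least \<open>v\<close>: if b
  \<ge> v a, then the next value 2 v b - 2 (m+1) a is at least v b, because 2 (m+1) a \<le> v^2 a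
  \<le> v b.\<close>

lemma gauss_poly_ge:
  assumes v: "v > 0" "v\<^sup>2 \<ge> 2 * real j" and "m \<le> j"
  shows "poly (gauss_poly m) (- v) \<ge> v ^ m"
proof -
  have step: "poly (gauss_poly m) (- v) > 0 \<and>
      poly (gauss_poly (Suc m)) (- v) \<ge> v * poly (gauss_poly m) (- v)" if "m \<le> j" for m
    using that
  proof (induction m)
    case 0
    then show ?case using v by simp
  next
    case (Suc m)
    let ?a = "poly (gauss_poly m) (- v)" and ?b = "poly (gauss_poly (Suc m)) (- v)"
    have ab: "?a > 0" "?b \<ge> v * ?a" using Suc by auto
    have b: "?b > 0" using ab v by (meson less_le_trans mult_pos_pos)
    have "2 * real (Suc m) * ?a \<le> v\<^sup>2 * ?a"
      using Suc.prems ab v by (intro mult_right_mono) auto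
    also have "\<dots> \<le> v * ?b" using ab v by (simp add: power2_eq_square mult_left_mono)
    finally show ?case using b by (simp only: poly_gauss_poly_Suc_Suc) simp
  qed
  show ?thesis using \<open>m \<le> j\<close>
  proof (induction m)
    case 0
    show ?case by simp
  next
    case (Suc m)
    have "v ^ Suc m \<le> v * poly (gauss_poly m) (- v)" using Suc v by simp
    also have "\<dots> \<le> poly (gauss_poly (Suc m)) (- v)" using step[of m] Suc.prems by simp
    finally show ?case .
  qed
qed

text \<open>The \<open>m\<close>-th derivative of the Gaussian with centre \<open>c\<close> and
  inverse width \<open>\<xi>\<close>.\<close>

definition hump :: "real \<Rightarrow> real \<Rightarrow> nat \<Rightarrow> real \<Rightarrow> real" where
  "hump \<xi> c m y = \<xi> ^ m * poly (gauss_poly m) (\<xi> * (y - c)) * exp (- (\<xi> * (y - c))\<^sup>2)"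

lemma deriv_seq_hump: "deriv_seq (hump \<xi> c)"
  unfolding deriv_seq_def
proof (intro allI)
  fix n y
  have "((\<lambda>u. poly (gauss_poly n) u * exp (- u\<^sup>2)) has_real_derivative
      poly (gauss_poly (Suc n)) u * exp (- u\<^sup>2)) (at u)" for u
    by (auto intro!: derivative_eq_intros poly_DERIV simp: algebra_simps)
  then have "((\<lambda>y. poly (gauss_poly n) (\<xi> * (y - c)) * exp (- (\<xi> * (y - c))\<^sup>2)) has_real_derivative
      poly (gauss_poly (Suc n)) (\<xi> * (y - c)) * exp (- (\<xi> * (y - c))\<^sup>2) * \<xi>) (at y)"
    by (rule DERIV_chain2) (auto intro!: derivative_eq_intros)
  from DERIV_cmult[OF this, of "\<xi> ^ n"]
  show "(hump \<xi> c n has_real_derivative hump \<xi> c (Suc n) y) (at y)"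
    unfolding hump_def[abs_def] by (simp add: mult_ac del: gauss_poly.simps)
qed


subsection \<open>Sums of Gaussians\<close>

lemma power_le_fact_mult_exp:
  fixes t :: real
  assumes "t \<ge> 0"
  shows "t ^ n \<le> fact n * exp t"
proof -
  have "(\<Sum>i\<in>{n}. t ^ i /\<^sub>R fact i) \<le> (\<Sum>i. t ^ i /\<^sub>R fact i)"
    using assms by (intro sum_le_suminf summable_exp_generic) auto
  then show ?thesis by (simp add: exp_def field_simps)
qed

text \<open>The exponential series at \<open>T / s\<close> bounds one of its terms; raise this to
  the power \<open>s\<close>.\<close>

lemma powr_mult_exp_le_fact:
  fixes s T :: real
  assumes "s > 0" "T > 0"
  shows "(T powr s) ^ n * exp (- T) \<le> (s powr s) ^ n * fact n powr s"
proof -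
  have "(T / s) ^ n \<le> fact n * exp (T / s)"
    using assms by (intro power_le_fact_mult_exp) simp
  then have "T ^ n \<le> s ^ n * fact n * exp (T / s)"
    using assms by (simp add: field_simps)
  then have "(T ^ n) powr s \<le> (s ^ n * fact n * exp (T / s)) powr s"
    using assms by (intro powr_mono2) auto
  also have "\<dots> = (s ^ n) powr s * fact n powr s * exp T"
    using assms by (simp add: powr_mult exp_powr_real)
  finally show ?thesis
    using assms by (simp add: powr_power powr_realpow[symmetric] powr_powr exp_minus field_simps)
qed

text \<open>One factor exp(-k) of the weight is spent on the estimate, the other survives to make
  the series converge. The exponent \<open>s - 1 / 2\<close> leaves room for the factor of order
  sqrt T that each derivative brings.\<close>

lemma hump_bound:
  fixes k :: nat
  assumes s: "s \<ge> 1" and A: "A \<ge> 1" and k: "k \<ge> 1" and c: "\<bar>c\<bar> \<le> A * real k powr s"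
  shows "exp (- 2 * real k) * \<bar>y ^ l * hump (real k powr (s - 1 / 2)) c j y\<bar>
    \<le> exp (- real k) * ((4 * A * exp 1 * s powr s) ^ (j + l) * fact (j + l) powr s)"
proof -
  define \<xi> where "\<xi> = real k powr (s - 1 / 2)"
  define u where "u = \<xi> * (y - c)"
  \<comment> \<open>\<open>T\<close> dominates all of \<open>k\<close>, \<open>u\<^sup>2\<close>, \<open>j\<close>, so that \<open>\<bar>y\<bar>\<close> and the growth factor of one derivative are both
    \<open>O(T\<^sup>s)\<close>, while \<open>exp(-k - u\<^sup>2)\<close> is \<open>exp(-T)\<close> up to a geometric factor.\<close>
  define T where "T = real k + u\<^sup>2 + real (j + l)"
  have T: "T \<ge> 1" "T \<ge> real k" "T \<ge> u\<^sup>2" "T \<ge> real j" using k by (auto simp: T_def add_increasing2)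
  have \<xi>: "\<xi> \<ge> 1" using k s by (simp add: \<xi>_def ge_one_powr_ge_zero)
  have sT: "sqrt T = T powr (1 / 2)" using T by (simp add: powr_half_sqrt)
  have u_le: "\<bar>u\<bar> \<le> sqrt T" using T(3) by (metis real_sqrt_abs real_sqrt_le_mono)
  have "sqrt T \<le> T powr s" unfolding sT using T s by (intro powr_mono) auto
  moreover have "real k powr s \<le> T powr s" using T s by (intro powr_mono2) auto
  moreover have "T powr s \<le> A * T powr s" using A by (simp add: mult_le_cancel_right1)
  moreover have "\<bar>y\<bar> \<le> \<bar>c\<bar> + \<bar>u\<bar>"
  proof -
    have "\<bar>y - c\<bar> \<le> \<xi> * \<bar>y - c\<bar>" using \<xi> by (simp add: mult_le_cancel_right1)
    also have "\<dots> = \<bar>u\<bar>" using \<xi> by (simp add: u_def abs_mult)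
    finally show ?thesis by linarith
  qed
  moreover have "A * real k powr s \<le> A * T powr s" using A calculation(2) by (simp add: mult_left_mono)
  ultimately have y: "\<bar>y\<bar> \<le> 4 * A * T powr s" using c u_le by linarith
  have "2 * \<bar>u\<bar> + 2 * sqrt j \<le> 4 * T powr (1 / 2)"
    using u_le T(4) real_sqrt_le_mono[of j T] unfolding sT by linarith
  moreover have "\<xi> \<le> T powr (s - 1 / 2)" unfolding \<xi>_def using T s by (intro powr_mono2) auto
  ultimately have "\<xi> * (2 * \<bar>u\<bar> + 2 * sqrt j) \<le> T powr (s - 1 / 2) * (4 * T powr (1 / 2))"
    by (intro mult_mono) auto
  also have "\<dots> = 4 * T powr s" by (simp add: powr_add[symmetric])
  also have "\<dots> \<le> 4 * A * T powr s" using A by (simp add: mult_le_cancel_right1)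
  finally have \<xi>u: "\<xi> * (2 * \<bar>u\<bar> + 2 * sqrt j) \<le> 4 * A * T powr s" .
  have "\<bar>y ^ l * hump \<xi> c j y\<bar> = \<bar>y\<bar> ^ l * (\<xi> ^ j * \<bar>poly (gauss_poly j) u\<bar>) * exp (- u\<^sup>2)"
    using \<xi> by (simp add: hump_def u_def[symmetric] abs_mult power_abs)
  also have "\<dots> \<le> \<bar>y\<bar> ^ l * (\<xi> ^ j * (2 * \<bar>u\<bar> + 2 * sqrt j) ^ j) * exp (- u\<^sup>2)"
    using \<xi> by (intro mult_right_mono mult_left_mono gauss_poly_bound) auto
  also have "\<dots> = \<bar>y\<bar> ^ l * (\<xi> * (2 * \<bar>u\<bar> + 2 * sqrt j)) ^ j * exp (- u\<^sup>2)"
    by (simp add: power_mult_distrib)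
  also have "\<dots> \<le> (4 * A * T powr s) ^ l * (4 * A * T powr s) ^ j * exp (- u\<^sup>2)"
    using power_mono[OF y, of l] power_mono[OF \<xi>u, of j] \<xi> A
    by (intro mult_right_mono mult_mono) auto
  also have "\<dots> = (4 * A) ^ (j + l) * (T powr s) ^ (j + l) * exp (- u\<^sup>2)"
    by (simp add: power_add power_mult_distrib)
  finally have "exp (- 2 * real k) * \<bar>y ^ l * hump \<xi> c j y\<bar> \<le>
      exp (- 2 * real k) * ((4 * A) ^ (j + l) * (T powr s) ^ (j + l) * exp (- u\<^sup>2))"
    by (intro mult_left_mono) auto
  also have "\<dots> = (4 * A) ^ (j + l) * (T powr s) ^ (j + l) * exp (- 2 * real k - u\<^sup>2)"
    by (simp add: exp_diff exp_minus field_simps)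
  also have "exp (- 2 * real k - u\<^sup>2) = exp (- real k) * exp 1 ^ (j + l) * exp (- T)"
    by (simp add: exp_of_nat_mult[symmetric] mult_exp_exp T_def)
  also have "(4 * A) ^ (j + l) * (T powr s) ^ (j + l) * (exp (- real k) * exp 1 ^ (j + l) * exp (- T)) =
      exp (- real k) * (4 * A * exp 1) ^ (j + l) * ((T powr s) ^ (j + l) * exp (- T))"
    by (simp add: power_mult_distrib)
  also have "\<dots> \<le> exp (- real k) * (4 * A * exp 1) ^ (j + l) * ((s powr s) ^ (j + l) * fact (j + l) powr s)"
    using A s T by (intro mult_left_mono powr_mult_exp_le_fact) auto
  also have "\<dots> = exp (- real k) * ((4 * A * exp 1 * s powr s) ^ (j + l) * fact (j + l) powr s)"
    by (simp add: power_mult_distrib)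
  finally show ?thesis by (simp add: \<xi>_def)
qed

text \<open>Any positive power of the factorial absorbs geometric growth; this is how a gap between
  two exponents yields the bound for every \<open>h\<close>.\<close>

lemma power_le_fact_powr:
  fixes K e :: real
  assumes "K > 0" "e > 0"
  shows "\<exists>C. \<forall>n. K ^ n \<le> C * fact n powr e"
proof -
  define b where "b = K powr (1 / e)"
  have b: "b > 0" using assms by (simp add: b_def)
  have "K ^ n \<le> exp b powr e * fact n powr e" for n
  proof -
    have "b ^ n \<le> exp b * fact n"
      using power_le_fact_mult_exp[of b n] b by (simp add: mult.commute)
    then have "(b ^ n) powr e \<le> (exp b * fact n) powr e"
      using assms b by (intro powr_mono2) auto
    moreover have "(b ^ n) powr e = K ^ n"
      using assms b by (simp add: b_def powr_realpow[symmetric] powr_powr)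
    ultimately show ?thesis by (simp add: powr_mult)
  qed
  then show ?thesis by blast
qed

locale hump_series =
  fixes s A :: real and c :: "nat \<Rightarrow> real"
  assumes s: "s \<ge> 1" and A: "A \<ge> 1" and c: "k \<ge> 1 \<Longrightarrow> \<bar>c k\<bar> \<le> A * real k powr s"
begin

definition summand :: "nat \<Rightarrow> nat \<Rightarrow> real \<Rightarrow> real" where
  "summand k m y = (if k = 0 then 0 else exp (- 2 * real k) * hump (real k powr (s - 1 / 2)) (c k) m y)"

text \<open>The set \<open>B\<close> of active humps stays free so that it can be chosen later; the
  estimates below are uniform in it.\<close>

definition hsum :: "nat set \<Rightarrow> nat \<Rightarrow> real \<Rightarrow> real" where
  "hsum B m y = (\<Sum>k. of_bool (k \<in> B) * summand k m y)"

abbreviation "K \<equiv> 4 * A * exp 1 * s powr s"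

lemma K_pos: "K > 0"
  using A s by simp

lemma summand_bound:
  "\<bar>of_bool (k \<in> B) * (y ^ l * summand k j y)\<bar> \<le> exp (- 1) ^ k * (K ^ (j + l) * fact (j + l) powr s)"
proof (cases "k \<in> B \<and> k \<noteq> 0")
  case True
  have e: "exp (- 1) ^ k = exp (- real k)" by (simp add: exp_of_nat_mult[symmetric])
  show ?thesis
    using hump_bound[OF s A _ c, of k y l j] True unfolding e
    by (simp add: summand_def abs_mult mult_ac)
next
  case False
  then show ?thesis using K_pos by (auto simp: summand_def)
qed

lemma summable_exp_bound: "summable (\<lambda>k. exp (- 1) ^ k * (a :: real))"
  by (intro summable_mult2 summable_geometric) simp

lemma summable_summand: "summable (\<lambda>k. of_bool (k \<in> B) * summand k m y)"
proof (rule summable_comparison_test'[OF summable_exp_bound, of 0])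
  show "norm (of_bool (k \<in> B) * summand k m y) \<le> exp (- 1) ^ k * (K ^ m * fact m powr s)" for k
    using summand_bound[of k B y 0 m] by simp
qed

text \<open>Termwise differentiation: \<open>summand_bound\<close> is a majorant independent of the
  point, so the differentiated series converges uniformly.\<close>

lemma deriv_seq_hsum: "deriv_seq (hsum B)"
  unfolding deriv_seq_def
proof (intro allI)
  fix m x
  have "((\<lambda>y. \<Sum>k. of_bool (k \<in> B) * summand k m y) has_real_derivative
      (\<Sum>k. of_bool (k \<in> B) * summand k (Suc m) x)) (at x)"
  proof (rule has_field_derivative_series'(2)[of UNIV])
    fix k y
    have "(summand k m has_real_derivative summand k (Suc m) y) (at y)"
      using deriv_seq_hump unfolding deriv_seq_def summand_def[abs_def]
      by (cases "k = 0") (auto intro!: DERIV_cmult)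
    then show "((\<lambda>y. of_bool (k \<in> B) * summand k m y) has_real_derivative
        of_bool (k \<in> B) * summand k (Suc m) y) (at y)"
      by (rule DERIV_cmult)
  next
    show "uniformly_convergent_on UNIV (\<lambda>n y. \<Sum>k<n. of_bool (k \<in> B) * summand k (Suc m) y)"
    proof (rule Weierstrass_m_test'[OF _ summable_exp_bound])
      show "norm (of_bool (k \<in> B) * summand k (Suc m) y) \<le>
          exp (- 1) ^ k * (K ^ Suc m * fact (Suc m) powr s)" for k y
        using summand_bound[of k B y 0 "Suc m"] by simp
    qed
  qed (auto intro: summable_summand)
  then show "(hsum B m has_real_derivative hsum B (Suc m) x) (at x)"
    by (simp add: hsum_def[abs_def])
qed

text \<open>Summation gives growth K^n (n!)^s with n = \<open>j + l\<close>; the spare factor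
  (n!)^(d-s) absorbs (K/h)^n.\<close>

lemma hsum_in_gelfand_shilov:
  assumes "s < d"
  shows "(\<lambda>x. complex_of_real (hsum B 0 x)) \<in> gelfand_shilov d"
  unfolding deriv_seq_gelfand_shilov_iff[OF deriv_seq_hsum]
proof (intro allI impI)
  fix h :: real assume h: "h > 0"
  define S where "S = (\<Sum>k. exp (- 1 :: real) ^ k)"
  have S: "S \<ge> 0" unfolding S_def by (intro suminf_nonneg summable_geometric) auto
  obtain C where C: "\<And>n. (K / h) ^ n \<le> C * fact n powr (d - s)"
    using power_le_fact_powr[of "K / h" "d - s"] h K_pos assms by auto
  have "\<bar>x ^ l * hsum B j x\<bar> \<le> S * C * (h ^ (j + l) * fact (j + l) powr d)" for x j l
  proof -
    define M where "M = K ^ (j + l) * fact (j + l) powr s"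
    have "\<bar>x ^ l * hsum B j x\<bar> = \<bar>\<Sum>k. of_bool (k \<in> B) * (x ^ l * summand k j x)\<bar>"
      unfolding hsum_def by (subst suminf_mult[OF summable_summand, symmetric]) (simp add: mult_ac)
    also have "\<dots> \<le> (\<Sum>k. exp (- 1) ^ k * M)"
      unfolding real_norm_def[symmetric] M_def
      by (intro norm_suminf_le summable_exp_bound) (use summand_bound in simp)
    also have "\<dots> = S * M"
      unfolding S_def by (intro suminf_mult2[symmetric] summable_geometric) simp
    also have "\<dots> \<le> S * (C * (h ^ (j + l) * fact (j + l) powr d))"
    proof (intro mult_left_mono S)
      have "K ^ (j + l) \<le> C * fact (j + l) powr (d - s) * h ^ (j + l)"
        using C[of "j + l"] h by (simp add: power_divide pos_divide_le_eq)
      then have "M \<le> C * fact (j + l) powr (d - s) * h ^ (j + l) * fact (j + l) powr s"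
        unfolding M_def by (intro mult_right_mono) auto
      also have "\<dots> = C * (h ^ (j + l) * fact (j + l) powr d)"
        by (simp add: powr_diff)
      finally show "M \<le> C * (h ^ (j + l) * fact (j + l) powr d)" .
    qed
    finally show ?thesis by (simp add: mult_ac)
  qed
  then show "\<exists>C. \<forall>x j l. \<bar>x ^ l * hsum B j x\<bar> \<le> C * (h ^ (j + l) * fact (j + l) powr d)"
    by blast
qed

lemma hsum_Un:
  assumes "B \<inter> B' = {}"
  shows "hsum (B \<union> B') m y = hsum B m y + hsum B' m y"
proof -
  have "of_bool (k \<in> B \<union> B') * summand k m y =
      of_bool (k \<in> B) * summand k m y + of_bool (k \<in> B') * summand k m y" for k
    using assms by auto
  then show ?thesis
    unfolding hsum_def by (simp add: suminf_add[OF summable_summand summable_summand])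
qed

text \<open>In scaled units \<open>y\<close> lies at least \<open>sqrt (2 * real k')\<close> left of
  the centre of each hump k' in \<open>B\<close>, so \<open>gauss_poly_ge\<close> makes the
  derivatives up to order \<open>k\<close> non-negative. For order \<open>k\<close>, hump
  \<open>k\<close> alone gives the bound.\<close>

lemma hsum_right_ge:
  assumes B: "B \<subseteq> {k..}" "k \<in> B" and k: "k \<ge> 1"
    and y: "y = c k - sqrt (2 * real k) / real k powr (s - 1 / 2)"
    and le: "\<And>k'. k' \<ge> k \<Longrightarrow> y \<le> c k' - sqrt (2 * real k') / real k' powr (s - 1 / 2)"
  shows "i \<le> k \<Longrightarrow> hsum B i y \<ge> 0"
    and "hsum B k y \<ge> exp (- 4 * real k) * (real k powr s) ^ k"
proof -
  have left: "v > 0 \<and> v\<^sup>2 \<ge> 2 * real k'"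
    if "k' \<ge> k" "v = - (real k' powr (s - 1 / 2) * (y - c k'))" for k' v
  proof -
    have "real k' powr (s - 1 / 2) > 0" using that k by simp
    then have "sqrt (2 * real k') \<le> v" using le[OF that(1)] that(2) by (simp add: field_simps)
    moreover have "0 < sqrt (2 * real k')" using that k by simp
    ultimately show ?thesis using sqrt_le_D less_le_trans by blast
  qed
  have nonneg: "summand k' i y \<ge> 0" if "k' \<ge> k" "i \<le> k" for k' i
  proof -
    obtain v where v: "v = - (real k' powr (s - 1 / 2) * (y - c k'))" by blast
    have "poly (gauss_poly i) (- v) \<ge> v ^ i"
      using left[OF that(1) v] that by (intro gauss_poly_ge[of _ k']) auto
    moreover have "v ^ i \<ge> 0" using left[OF that(1) v] by simp
    ultimately show ?thesis using v by (simp add: summand_def hump_def)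
  qed
  have nonneg': "of_bool (k' \<in> B) * summand k' i y \<ge> 0" if "i \<le> k" for k' i
    using nonneg[of k' i] that B by auto
  show "hsum B i y \<ge> 0" if "i \<le> k"
    unfolding hsum_def using nonneg'[OF that] by (intro suminf_nonneg summable_summand)
  have "summand k k y = (\<Sum>k'\<in>{k}. of_bool (k' \<in> B) * summand k' k y)" using B by simp
  also have "\<dots> \<le> hsum B k y"
    unfolding hsum_def using nonneg' by (intro sum_le_suminf summable_summand) auto
  finally have 1: "summand k k y \<le> hsum B k y" .
  define \<xi> where "\<xi> = real k powr (s - 1 / 2)"
  define v where "v = sqrt (2 * real k)"
  have \<xi>: "\<xi> > 0" and v: "v > 0" "v\<^sup>2 = 2 * real k" using k by (auto simp: \<xi>_def v_def)
  have arg: "\<xi> * (y - c k) = - v" using \<xi> by (simp add: y \<xi>_def[symmetric] v_def)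
  have "real k powr s = \<xi> * real k powr (1 / 2)" by (simp add: \<xi>_def powr_add[symmetric])
  also have "\<dots> \<le> \<xi> * v" using \<xi> by (simp add: powr_half_sqrt v_def)
  finally have "(real k powr s) ^ k \<le> (\<xi> * v) ^ k" by (intro power_mono) auto
  also have "\<dots> \<le> \<xi> ^ k * poly (gauss_poly k) (- v)"
    using \<xi> v gauss_poly_ge[of v k k] by (simp add: power_mult_distrib)
  finally have "exp (- 4 * real k) * (real k powr s) ^ k \<le>
      exp (- 4 * real k) * (\<xi> ^ k * poly (gauss_poly k) (- v))" by simp
  \<comment> \<open>The exponent -4k collects -2k from the weight and -v^2 = -2k from the
    Gaussian.\<close>
  also have "\<dots> = summand k k y"
    using k v(2) by (simp add: summand_def hump_def \<xi>_def[symmetric] arg mult_exp_exp mult_ac)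
  finally show "hsum B k y \<ge> exp (- 4 * real k) * (real k powr s) ^ k" using 1 by linarith
qed

end

subsection \<open>The gliding hump\<close>

text \<open>Each new index is taken so far out that its contribution beats the bound for the finite
  set chosen before it.\<close>

lemma gliding_hump:
  fixes L :: "nat set \<Rightarrow> nat \<Rightarrow> real"
  assumes add: "\<And>B B' k. B \<inter> B' = {} \<Longrightarrow> L (B \<union> B') k = L B k + L B' k"
    and bounded: "\<And>B. finite B \<Longrightarrow> \<exists>C. \<forall>k. \<bar>L B k\<bar> \<le> C * w k"
    and large: "\<And>M. \<forall>\<^sub>F k in sequentially. \<forall>R. R \<subseteq> {k..} \<longrightarrow> k \<in> R \<longrightarrow> L R k \<ge> M * w k"
  shows "\<exists>B. \<forall>n :: nat. \<exists>k. L B k \<ge> real n * w k"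
proof -
  \<comment> \<open>Later choices are still unknown, so the estimate is demanded for every possible
    tail \<open>R\<close> with least element \<open>k\<close>.\<close>
  define Q where "Q n B B' \<longleftrightarrow> (\<exists>k. B' = insert k B \<and> (\<forall>b\<in>B. b < k) \<and>
      (\<forall>R. R \<subseteq> {k..} \<longrightarrow> k \<in> R \<longrightarrow> L B k + L R k \<ge> real n * w k))" for n B B'
  have "\<exists>Bs :: nat \<Rightarrow> nat set. \<forall>n. finite (Bs n) \<and> Q n (Bs n) (Bs (Suc n))"
  proof (rule dependent_nat_choice)
    fix B :: "nat set" and n assume fin: "finite B"
    obtain C where C: "\<And>k. \<bar>L B k\<bar> \<le> C * w k" using bounded[OF fin] by blast
    have "\<forall>\<^sub>F k in sequentially. \<forall>b\<in>B. b < k"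
      using fin by (simp add: eventually_ball_finite_distrib eventually_gt_at_top)
    then have "\<forall>\<^sub>F k in sequentially. (\<forall>b\<in>B. b < k) \<and>
        (\<forall>R. R \<subseteq> {k..} \<longrightarrow> k \<in> R \<longrightarrow> L R k \<ge> (C + real n) * w k)"
      using large by (rule eventually_conj)
    then obtain k where k: "\<forall>b\<in>B. b < k"
        "\<And>R. R \<subseteq> {k..} \<Longrightarrow> k \<in> R \<Longrightarrow> L R k \<ge> (C + real n) * w k"
      by (auto simp: eventually_sequentially)
    have "L B k + L R k \<ge> real n * w k" if "R \<subseteq> {k..}" "k \<in> R" for R
      using k(2)[OF that] C[of k] by (simp add: algebra_simps)
    then show "\<exists>B'. finite B' \<and> Q n B B'"
      using fin k(1) unfolding Q_def by (intro exI[of _ "insert k B"]) auto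
  qed auto
  then obtain Bs where Bs: "\<And>n. Q n (Bs n) (Bs (Suc n))" by blast
  have mono: "Bs i \<subseteq> Bs j" if "i \<le> j" for i j
  proof (rule lift_Suc_mono_le[OF _ that])
    show "Bs n \<subseteq> Bs (Suc n)" for n using Bs[of n] unfolding Q_def by blast
  qed
  have "\<exists>k. L (\<Union>i. Bs i) k \<ge> real n * w k" for n
  proof -
    obtain k where k: "Bs (Suc n) = insert k (Bs n)" "\<forall>b\<in>Bs n. b < k"
        "\<And>R. R \<subseteq> {k..} \<Longrightarrow> k \<in> R \<Longrightarrow> L (Bs n) k + L R k \<ge> real n * w k"
      using Bs[of n] unfolding Q_def by blast
    define R where "R = (\<Union>i. Bs i) - Bs n"
    \<comment> \<open>Every index added after \<open>k\<close> exceeds all earlier ones,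
      \<open>k\<close> included.\<close>
    have "Bs j - Bs n \<subseteq> {k..}" if "n < j" for j
      using Suc_leI[OF that]
    proof (induction j rule: dec_induct)
      case base
      then show ?case using k(1) by auto
    next
      case (step j)
      obtain k' where "Bs (Suc j) = insert k' (Bs j)" "\<forall>b\<in>Bs j. b < k'"
        using Bs[of j] unfolding Q_def by blast
      moreover have "k \<in> Bs j" using mono[OF step(1)] k(1) by auto
      ultimately show ?case using step.IH by auto
    qed
    then have "Bs j - Bs n \<subseteq> {k..}" for j
      using mono[of j n] by (cases "n < j") auto
    then have "R \<subseteq> {k..}" unfolding R_def by fast
    moreover have "k \<in> R" unfolding R_def using k(1,2) by fast
    ultimately have "real n * w k \<le> L (Bs n) k + L R k" by (rule k(3))
    also have "\<dots> = L (\<Union>i. Bs i) k"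
    proof -
      have "Bs n \<inter> R = {}" "Bs n \<union> R = (\<Union>i. Bs i)" by (auto simp: R_def)
      then show ?thesis using add by metis
    qed
    finally show ?thesis by blast
  qed
  then show ?thesis by blast
qed

section \<open>Growth of polynomials and the final construction\<close>

lemma abs_poly_le_power:
  fixes p :: "real poly"
  assumes "x \<ge> 1"
  shows "\<bar>poly p x\<bar> \<le> (\<Sum>i\<le>degree p. \<bar>coeff p i\<bar>) * x ^ degree p"
proof -
  have "\<bar>poly p x\<bar> \<le> (\<Sum>i\<le>degree p. \<bar>coeff p i * x ^ i\<bar>)"
    unfolding poly_altdef by (rule sum_abs)
  also have "\<dots> \<le> (\<Sum>i\<le>degree p. \<bar>coeff p i\<bar> * x ^ degree p)"
    using assms by (intro sum_mono) (auto simp: abs_mult intro!: mult_left_mono power_increasing)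
  finally show ?thesis by (simp add: sum_distrib_right)
qed

text \<open>Subtracting half of the leading term leaves a polynomial with positive leading
  coefficient, which is eventually non-negative.\<close>

lemma eventually_poly_ge_power:
  fixes p :: "real poly"
  assumes "lead_coeff p > 0"
  shows "\<exists>\<kappa>>0. \<forall>\<^sub>F x in at_top. poly p x \<ge> \<kappa> * x ^ degree p"
proof -
  define \<kappa> where "\<kappa> = lead_coeff p / 2"
  define q where "q = p - monom \<kappa> (degree p)"
  have c: "coeff q (degree p) = \<kappa>" by (simp add: q_def \<kappa>_def)
  have \<kappa>: "\<kappa> > 0" using assms by (simp add: \<kappa>_def)
  have "degree q = degree p"
  proof (rule antisym)
    show "degree q \<le> degree p"
      unfolding q_def by (intro degree_diff_le) (auto simp: degree_monom_le)
    show "degree p \<le> degree q" using c \<kappa> by (intro le_degree) simp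
  qed
  then have "lead_coeff q > 0" using c \<kappa> by simp
  from poly_pinfty_gt_lc[OF this] obtain X where "\<And>x. x \<ge> X \<Longrightarrow> poly q x \<ge> 0"
    using \<open>lead_coeff q > 0\<close> by (meson less_le_trans less_imp_le)
  then have "\<forall>\<^sub>F x in at_top. poly p x \<ge> \<kappa> * x ^ degree p"
    unfolding eventually_at_top_linorder by (auto simp: q_def poly_monom)
  then show ?thesis using \<kappa> by blast
qed

lemma gelfand_shilov_comp_escape:
  fixes p :: "real poly"
  assumes lc: "lead_coeff p > 0" and N: "degree p = N" "N > 1"
    and d: "1 < d" "d \<le> d'" "d' < (2 * real N - 1) / real N * d"
  shows "\<exists>G. deriv_seq G \<and> (\<lambda>x. complex_of_real (G 0 x)) \<in> gelfand_shilov d \<and>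
    (\<lambda>x. complex_of_real (G 0 (poly p x))) \<notin> gelfand_shilov d'"
proof -
  \<comment> \<open>\<open>\<rho> * s\<close> is the sum of \<open>s\<close>, from the hump, and s
    (N-1) / N, from the derivative of \<open>p\<close> at \<open>x k\<close>.\<close>
  define \<rho> where "\<rho> = (2 * real N - 1) / real N"
  have \<rho>: "\<rho> > 0" "d' / \<rho> < d" using N d by (auto simp: \<rho>_def field_simps)
  obtain s where s_less: "max 1 (d' / \<rho>) < s" "s < d"
    using dense[of "max 1 (d' / \<rho>)" d] \<rho> d by auto
  have s1: "s > 1" and sd': "d' < \<rho> * s" using s_less \<rho> by (auto simp: field_simps)
  define x where "x k = real k powr (s / real N)" for k :: nat
  \<comment> \<open>The offset makes \<open>poly p (x k)\<close> exactly the point \<open>y\<close>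
    of \<open>hsum_right_ge\<close>; the \<open>+ 2\<close> in \<open>A\<close> pays for it.\<close>
  define c where "c k = poly p (x k) + sqrt (2 * real k) / real k powr (s - 1 / 2)" for k :: nat
  define A where "A = (\<Sum>i\<le>degree p. \<bar>coeff p i\<bar>) + 2"
  have pow_x: "x k ^ n = real k powr (s * real n / real N)" if "k \<ge> 1" for k n
    using that by (simp add: x_def powr_powr powr_realpow[symmetric])
  interpret hump_series s A c
  proof
    show "1 \<le> s" using s1 by simp
    show "1 \<le> A" by (simp add: A_def sum_nonneg add_increasing)
    fix k :: nat assume k: "1 \<le> k"
    have "x k \<ge> 1" unfolding x_def using k s1 by (intro ge_one_powr_ge_zero) auto
    then have "\<bar>poly p (x k)\<bar> \<le> (\<Sum>i\<le>degree p. \<bar>coeff p i\<bar>) * x k ^ N"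
      using abs_poly_le_power[of "x k" p] N by simp
    also have "x k ^ N = real k powr s" using N k by (simp add: pow_x)
    finally have 1: "\<bar>poly p (x k)\<bar> \<le> (\<Sum>i\<le>degree p. \<bar>coeff p i\<bar>) * real k powr s" .
    have "sqrt (2 * real k) / real k powr (s - 1 / 2) =
        sqrt 2 * (real k powr (1 / 2) / real k powr (s - 1 / 2))"
      by (simp add: real_sqrt_mult powr_half_sqrt)
    also have "\<dots> = sqrt 2 * real k powr (1 - s)" by (simp add: powr_diff[symmetric])
    also have "\<dots> \<le> 2 * real k powr s"
      using k s1 by (intro mult_mono powr_mono) (auto simp: sqrt2_less_2 less_imp_le)
    finally have "\<bar>sqrt (2 * real k) / real k powr (s - 1 / 2)\<bar> \<le> 2 * real k powr s" by simp
    with 1 show "\<bar>c k\<bar> \<le> A * real k powr s"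
      unfolding c_def A_def distrib_right by linarith
  qed
  have lc': "lead_coeff (pderiv p) > 0"
    using lc N by (simp add: degree_pderiv coeff_pderiv)
  obtain \<kappa> where \<kappa>: "\<kappa> > 0" "\<forall>\<^sub>F y in at_top. poly (pderiv p) y \<ge> \<kappa> * y ^ (N - 1)"
    using eventually_poly_ge_power[OF lc'] N by (auto simp: degree_pderiv)
  obtain X where X: "\<And>y. y \<ge> X \<Longrightarrow> poly (pderiv p) y \<ge> \<kappa> * y ^ (N - 1)"
      "\<And>y. y \<ge> X \<Longrightarrow> nonneg_taylor (pderiv p) y"
    using eventually_conj[OF \<kappa>(2) eventually_nonneg_taylor[OF lc']]
    unfolding eventually_at_top_linorder by blast
  have p_mono: "poly p a \<le> poly p b" if "X \<le> a" "a \<le> b" for a b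
  proof (rule DERIV_nonneg_imp_nondecreasing[OF that(2)])
    show "\<exists>D. (poly p has_real_derivative D) (at y) \<and> D \<ge> 0" if "a \<le> y" for y
      using nonneg_taylor_poly[OF X(2), of y] that \<open>X \<le> a\<close> by (intro exI[of _ "poly (pderiv p) y"]) simp
  qed
  define L where "L B k = comp_deriv (hsum B) p k 0 1 (x k)" for B k
  have L_ge: "L R k \<ge> (\<kappa> * exp (- 4) * real k powr (\<rho> * s)) ^ k"
    if "R \<subseteq> {k..}" "k \<in> R" "k \<ge> 1" "x k \<ge> X" for R k
  proof -
    have le: "poly p (x k) \<le> c k' - sqrt (2 * real k') / real k' powr (s - 1 / 2)" if "k' \<ge> k" for k'
    proof -
      have "x k \<le> x k'" unfolding x_def using that s1 by (intro powr_mono2) auto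
      then show ?thesis using p_mono[OF \<open>x k \<ge> X\<close>, of "x k'"] by (simp add: c_def)
    qed
    have y: "poly p (x k) = c k - sqrt (2 * real k) / real k powr (s - 1 / 2)" by (simp add: c_def)
    note right = hsum_right_ge[OF that(1-3) y le]
    have "(\<kappa> * exp (- 4) * real k powr (\<rho> * s)) ^ k =
        exp (- 4 * real k) * (real k powr s) ^ k * (\<kappa> * x k ^ (N - 1)) ^ k"
    proof -
      have "real k powr (\<rho> * s) = real k powr s * x k ^ (N - 1)"
        using N unfolding pow_x[OF \<open>k \<ge> 1\<close>] powr_add[symmetric]
        by (simp add: \<rho>_def of_nat_diff field_simps)
      then show ?thesis
        by (simp add: power_mult_distrib exp_of_nat_mult[symmetric] mult_ac)
    qed
    also have "\<dots> \<le> hsum R k (poly p (x k)) * poly (pderiv p) (x k) ^ k"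
      using right X(1)[OF that(4)] \<kappa>(1) by (intro mult_mono power_mono) (auto simp: x_def)
    also have "\<dots> \<le> L R k"
      using comp_deriv_ge[of p "x k" 0 k "hsum R" 1] X(2)[OF that(4)] right(1)
      by (simp add: L_def nonneg_taylor_def pcompose_1)
    finally show ?thesis .
  qed
  have large: "\<forall>\<^sub>F k in sequentially. \<forall>R. R \<subseteq> {k..} \<longrightarrow> k \<in> R \<longrightarrow> L R k \<ge> M * fact k powr d'" for M
  proof -
    \<comment> \<open>Since \<open>fact k\<close> is at most k^k, it is enough that the base of the
      lower bound exceeds k^d' by a factor 2: the power 2^k then outgrows \<open>M\<close>.\<close>
    have 1: "\<forall>\<^sub>F k in sequentially. \<kappa> * exp (- 4) * real k powr (\<rho> * s - d') \<ge> 2"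
      using \<kappa>(1) sd' by real_asymp
    have 2: "\<forall>\<^sub>F k in sequentially. x k \<ge> X"
      unfolding x_def using s1 N by real_asymp
    have 3: "\<forall>\<^sub>F k in sequentially. 2 ^ k \<ge> M" by real_asymp
    show ?thesis
      using 1 2 3 eventually_ge_at_top[of 1]
    proof eventually_elim
      case (elim k)
      have "M * fact k powr d' \<le> 2 ^ k * (real k powr d') ^ k"
      proof (intro mult_mono)
        have "fact k powr d' \<le> (real k ^ k) powr d'"
          using d fact_le_power[where 'a = real] by (intro powr_mono2) auto
        then show "fact k powr d' \<le> (real k powr d') ^ k"
          using elim by (simp add: powr_realpow[symmetric] powr_powr mult.commute)
      qed (use elim in auto)
      also have "\<dots> \<le> (\<kappa> * exp (- 4) * real k powr (\<rho> * s - d')) ^ k * (real k powr d') ^ k"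
        using elim by (intro mult_right_mono power_mono) auto
      also have "\<dots> = (\<kappa> * exp (- 4) * real k powr (\<rho> * s)) ^ k"
        by (simp add: power_mult_distrib[symmetric] powr_add[symmetric] mult.assoc)
      finally show ?case using L_ge elim by (meson order_trans)
    qed
  qed
  have comp_bound: "\<exists>C. \<forall>k. \<bar>L B k\<bar> \<le> C * fact k powr d'"
    if "(\<lambda>x. complex_of_real (hsum B 0 (poly p x))) \<in> gelfand_shilov d'" for B
  proof -
    have "(\<lambda>x. complex_of_real (comp_deriv (hsum B) p 0 0 1 x)) \<in> gelfand_shilov d'"
      using that by simp
    \<comment> \<open>Membership is used at h = 1, and then with \<open>l\<close> = 0, where the
      bound is a multiple of \<open>fact k powr d'\<close>.\<close>
    from deriv_seq_gelfand_shilov_iff[OF comp_deriv_seq[OF deriv_seq_hsum], THEN iffD1, OF this,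
        rule_format, OF zero_less_one]
    obtain C where "\<And>x j l. \<bar>x ^ l * comp_deriv (hsum B) p j 0 1 x\<bar> \<le> C * (1 ^ (j + l) * fact (j + l) powr d')"
      by blast
    from this[of _ 0] have "\<bar>L B k\<bar> \<le> C * fact k powr d'" for k
      by (simp add: L_def)
    then show ?thesis by blast
  qed
  have "\<exists>B. (\<lambda>x. complex_of_real (hsum B 0 (poly p x))) \<notin> gelfand_shilov d'"
  proof (rule ccontr)
    assume "\<not> ?thesis"
    \<comment> \<open>The negated claim supplies the boundedness that \<open>gliding_hump\<close>
      asks of finite sets, and also contradicts its conclusion.\<close>
    then have bounded: "\<exists>C. \<forall>k. \<bar>L B k\<bar> \<le> C * fact k powr d'" for B
      using comp_bound by blast
    have add: "L (B \<union> B') k = L B k + L B' k" if "B \<inter> B' = {}" for B B' k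
      unfolding L_def by (intro comp_deriv_add hsum_Un that)
    obtain B where B: "\<And>n. \<exists>k. L B k \<ge> real n * fact k powr d'"
      using gliding_hump[of L "\<lambda>k. fact k powr d'"] add bounded large by blast
    obtain C where C: "\<And>k. \<bar>L B k\<bar> \<le> C * fact k powr d'" using bounded by blast
    obtain n where n: "real n > C" using reals_Archimedean2 by blast
    obtain k where "L B k \<ge> real n * fact k powr d'" using B by blast
    with C[of k] have "real n * fact k powr d' \<le> C * fact k powr d'" by linarith
    with n show False by simp
  qed
  then show ?thesis
    using deriv_seq_hsum hsum_in_gelfand_shilov[OF s_less(2)] by blast
qed

theorem corollary3p8:
  fixes d :: real
  assumes "d > 1"
  shows "(\<forall>\<psi> :: real poly. \<forall>N :: nat. degree \<psi> = N \<and> N > 1 \<longrightarrow>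
            (\<forall>d' :: real. d \<le> d' \<and> d' < (2 * real N - 1) / real N * d \<longrightarrow>
              (\<exists>f \<in> gelfand_shilov d. f \<circ> poly \<psi> \<notin> gelfand_shilov d'))) \<and>
         (\<forall>\<psi> :: real poly. degree \<psi> > 1 \<longrightarrow>
            (\<forall>d' :: real. d \<le> d' \<and> d' < 3 / 2 * d \<longrightarrow>
              (\<exists>f \<in> gelfand_shilov d. f \<circ> poly \<psi> \<notin> gelfand_shilov d')))"
proof -
  have main: "\<exists>f \<in> gelfand_shilov d. f \<circ> poly \<psi> \<notin> gelfand_shilov d'"
    if N: "degree \<psi> = N" "N > 1" and d': "d \<le> d'" "d' < (2 * real N - 1) / real N * d"
    for \<psi> :: "real poly" and N d'
  proof (cases "lead_coeff \<psi> > 0")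
    case True
    then show ?thesis
      using gelfand_shilov_comp_escape[OF True N assms d'] by (auto simp: o_def)
  next
    case False
    \<comment> \<open>Compose with \<open>- \<psi>\<close> instead and reflect the function
      obtained.\<close>
    then have "lead_coeff (- \<psi>) > 0" "degree (- \<psi>) = N"
      using N by (auto simp: less_le)
    then obtain G where G: "deriv_seq G" "(\<lambda>x. complex_of_real (G 0 x)) \<in> gelfand_shilov d"
        "(\<lambda>x. complex_of_real (G 0 (poly (- \<psi>) x))) \<notin> gelfand_shilov d'"
      using gelfand_shilov_comp_escape[OF _ _ N(2) assms d'] by blast
    then show ?thesis
      using gelfand_shilov_reflect[OF G(1,2)]
      by (intro bexI[of _ "\<lambda>x. complex_of_real (G 0 (- x))"]) (auto simp: o_def)
  qed
  \<comment> \<open>The factor 2 - 1/N is smallest at N = 2, so the second claim follows from the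
    first.\<close>
  have "3 / 2 * d \<le> (2 * real N - 1) / real N * d" if "N > 1" for N :: nat
    using that assms by (intro mult_right_mono) (auto simp: field_simps)
  then show ?thesis
    using main by (meson less_le_trans)
qed

end
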